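(* Let $p\ge 3$ be a prime and let $b\ge 2$ be an integer with $p\nmid b$. Let $l$ be the multiplicative order of $b$ modulo $p$, assume that $l$ is odd, and write $l=(p-1)/q$ with $q$ a positive integer. Let $\chi$ be a Dirichlet character modulo $p$ of order $q$. Let $$\frac1p=\sum_{j=1}^{\infty}c_j b^{-j},\qquad c_j\in\{0,1,\ldots,b-1\},$$ be the digit expansion of $1/p$ with respect to the basis $b$, and let $S=\sum_{j=1}^{l}c_j$. Then $$S=\frac{b-1}{2}\cdot l+\frac{b-1}{2}\,E,$$ where $E$ is the mean value of the generalized Bernoulli numbers $B_\psi$ belonging to the odd characters $\psi$ in the group $\langle\chi\rangle$ generated by $\chi$, i.e., $$E=\frac{2}{q}\sum_{\substack{j=1\\ j\text{ odd}}}^{q-1}B_{\chi^j}.$$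
   Context: For a Dirichlet character $\psi$ modulo $p$ (complex-valued), the generalized Bernoulli number (of order $1$) belonging to $\psi$ is $$B_\psi=\frac1p\sum_{k=1}^{p-1}k\,\psi(k).$$ A character $\psi$ is odd if $\psi(-1)=-1$. The order of a character is its order in the group of Dirichlet characters modulo $p$. The digits of $1/p$ with respect to the basis $b$ are the numbers $c_j$ ($j\ge1$); the sequence is periodic and $(c_1,\ldots,c_l)$ is a period. Since $l$ is odd and $p-1$ is even, $q$ is even. *)

theory Defs
  imports Complex_Main "HOL-Algebra.Generated_Groups" "HOL-Number_Theory.Number_Theory"
begin

text \<open>
  Dirichlet characters are functions on all of \<open>\<int>\<close>, extended by zero to the integers
  that are not coprime to the modulus. In particular \<open>\<psi> 1 = 1\<close> follows from
  multiplicativity and \<open>\<psi> 1 \<noteq> 0\<close>.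
\<close>

definition dirichlet_character :: "nat \<Rightarrow> (int \<Rightarrow> complex) \<Rightarrow> bool" where
  "dirichlet_character n \<psi> \<longleftrightarrow>
     (\<forall>a b. \<psi> (a * b) = \<psi> a * \<psi> b) \<and>
     (\<forall>a b. [a = b] (mod int n) \<longrightarrow> \<psi> a = \<psi> b) \<and>
     (\<forall>a. \<psi> a \<noteq> 0 \<longleftrightarrow> coprime a (int n))"

definition dirichlet_group :: "nat \<Rightarrow> (int \<Rightarrow> complex) monoid" where
  "dirichlet_group n =
     \<lparr> carrier = {\<psi>. dirichlet_character n \<psi>},
       monoid.mult = (\<lambda>\<phi> \<psi> a. \<phi> a * \<psi> a),
       one = (\<lambda>a. if coprime a (int n) then 1 else 0) \<rparr>"

lemma comm_group_dirichlet_group: "comm_group (dirichlet_group n)"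
proof (rule comm_groupI)
  fix \<psi> assume "\<psi> \<in> carrier (dirichlet_group n)"
  then have \<psi>: "dirichlet_character n \<psi>" by (simp add: dirichlet_group_def)
  then have "dirichlet_character n (\<lambda>a. inverse (\<psi> a))"
    unfolding dirichlet_character_def by (auto intro: arg_cong[where f = inverse])
  moreover have "(\<lambda>a. inverse (\<psi> a) * \<psi> a) = (\<lambda>a. if coprime a (int n) then 1 else 0)"
    using \<psi> unfolding dirichlet_character_def by (intro ext) (auto simp del: mult_eq_0_iff)
  ultimately show "\<exists>\<phi>\<in>carrier (dirichlet_group n).
      \<phi> \<otimes>\<^bsub>dirichlet_group n\<^esub> \<psi> = \<one>\<^bsub>dirichlet_group n\<^esub>"
    by (intro bexI[of _ "\<lambda>a. inverse (\<psi> a)"]) (simp_all add: dirichlet_group_def)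
next
  show "\<one>\<^bsub>dirichlet_group n\<^esub> \<in> carrier (dirichlet_group n)"
    by (auto simp: dirichlet_group_def dirichlet_character_def coprime_mult_left_iff
             dest: cong_imp_coprime cong_sym)
qed (auto simp: dirichlet_group_def dirichlet_character_def fun_eq_iff)

definition gen_bernoulli :: "nat \<Rightarrow> (int \<Rightarrow> complex) \<Rightarrow> complex" where
  "gen_bernoulli n \<psi> = 1 / of_nat n * (\<Sum>k = 1..n - 1. of_nat k * \<psi> (int k))"

definition odd_character :: "(int \<Rightarrow> complex) \<Rightarrow> bool" where
  "odd_character \<psi> \<longleftrightarrow> \<psi> (- 1) = - 1"

end

theory Submission
  imports Defs
begin

text \<open>
  The remainders of the long division of \<open>1\<close> by \<open>p\<close> are the powers of \<open>b\<close> modulo \<open>p\<close>, so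
  \<open>p * S = (b - 1) * T\<close>, where \<open>T\<close> is the sum of these remainders. They are exactly the residues
  in the kernel of \<open>\<chi>\<close>. As \<open>l\<close> is odd, \<open>-1\<close> is not among them, hence \<open>\<chi> (-1) = -1\<close>, and the odd
  characters in \<open>\<langle>\<chi>\<rangle>\<close> are the odd powers of \<open>\<chi>\<close>. Summing these over the exponents gives \<open>q / 2\<close> on
  the kernel, \<open>- q / 2\<close> on its negative and \<open>0\<close> elsewhere, so that \<open>E = 2 * T / p - l\<close>.
\<close>

section \<open>Digits of 1/p and long division\<close>

text \<open>Comparison with the geometric series of the largest digit \<open>b - 1\<close>, whose
  value is 1. The upper bound cannot be strict, since all digits may equal
  \<open>b - 1\<close>.\<close>

lemma digit_series_bounds:
  fixes d :: "nat \<Rightarrow> nat" and b :: nat and x :: real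
  assumes "b \<ge> 2" and le: "\<And>j. d j \<le> b - 1"
    and sums: "(\<lambda>j. real (d j) / real b ^ Suc j) sums x"
  shows "0 \<le> x" "x \<le> 1"
proof -
  have "(\<lambda>j. 0) sums (0::real)" by simp
  then show "0 \<le> x" by (rule sums_le[OF _ _ sums, rotated]) simp
  have "(\<lambda>j. (1 / real b) ^ j) sums (1 / (1 - 1 / real b))"
    using \<open>b \<ge> 2\<close> by (intro geometric_sums) simp
  from sums_mult[OF this, of "(real b - 1) / real b"]
  have "(\<lambda>j. (real b - 1) / real b ^ Suc j) sums 1"
    using \<open>b \<ge> 2\<close> by (simp add: field_simps)
  moreover have "real (d j) \<le> real b - 1" for j
    using le[of j] \<open>b \<ge> 2\<close> by linarith
  ultimately show "x \<le> 1"
    by (intro sums_le[OF _ sums]) (auto intro!: divide_right_mono)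
qed

text \<open>This is long division: multiplying a tail by \<open>b\<close> and removing its leading
  digit gives the next tail. Both claims come from one induction step, because the digit relation
  follows once the next tail is identified.\<close>

lemma digit_tail_sums:
  fixes p b :: nat and c :: "nat \<Rightarrow> nat"
  assumes "p > 1" "coprime p b" "b \<ge> 2" and le: "\<And>j. c (Suc j) \<le> b - 1"
    and sums: "(\<lambda>j. real (c (Suc j)) / real b ^ Suc j) sums (1 / real p)"
  shows "(\<lambda>j. real (c (n + Suc j)) / real b ^ Suc j) sums (real (b ^ n mod p) / real p)"
    and "p * c (Suc n) + b ^ Suc n mod p = b * (b ^ n mod p)"
proof -
  have step: "(\<lambda>j. real (c (Suc n + Suc j)) / real b ^ Suc j) sums (real (b ^ Suc n mod p) / real p)
      \<and> p * c (Suc n) + b ^ Suc n mod p = b * (b ^ n mod p)"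
    if IH: "(\<lambda>j. real (c (n + Suc j)) / real b ^ Suc j) sums (real (b ^ n mod p) / real p)" for n
  proof -
    \<comment> \<open>\<open>x\<close> is the value of the next tail and \<open>m\<close> is
      \<open>p * x\<close>, visibly an integer. It is taken in \<open>int\<close> because its sign
      is not yet known.\<close>
    define x where "x = real b * (real (b ^ n mod p) / real p) - real (c (Suc n))"
    define m where "m = int b * int (b ^ n mod p) - int p * int (c (Suc n))"
    have "(\<lambda>j. real b * (real (c (n + Suc j)) / real b ^ Suc j)) sums
        (x + real b * (real (c (n + Suc 0)) / real b ^ Suc 0))"
      using sums_mult[OF IH, of "real b"] \<open>b \<ge> 2\<close> by (simp add: x_def)
    then have "(\<lambda>j. real b * (real (c (n + Suc (Suc j))) / real b ^ Suc (Suc j))) sums x"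
      by (subst sums_Suc_iff)
    then have tail: "(\<lambda>j. real (c (Suc n + Suc j)) / real b ^ Suc j) sums x"
      using \<open>b \<ge> 2\<close> by simp
    have "0 \<le> x" "x \<le> 1"
      using digit_series_bounds[OF \<open>b \<ge> 2\<close> _ tail] le by auto
    moreover have mx: "real_of_int m = real p * x"
      using \<open>p > 1\<close> by (simp add: m_def x_def field_simps)
    ultimately have "0 \<le> real_of_int m" "real_of_int m \<le> real p"
      using \<open>p > 1\<close> by (simp_all add: mult_left_le)
    then have m: "0 \<le> m" "m \<le> int p" by linarith+
    have cong: "[m = int (b ^ Suc n)] (mod int p)"
    proof -
      have "[m = int b * int (b ^ n mod p)] (mod int p)"
        by (simp add: m_def cong_iff_dvd_diff)
      also have "[int b * int (b ^ n mod p) = int b * int (b ^ n)] (mod int p)"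
        by (intro cong_mult cong_refl) (simp add: cong_def zmod_int)
      finally show ?thesis by simp
    qed
    \<comment> \<open>The bounds leave \<open>m = p\<close> possible, the case of a tail with value
      1. Since \<open>m\<close> is congruent to a power of \<open>b\<close>, it is not divisible by
      \<open>p\<close>, so it is the remainder itself.\<close>
    have "coprime p (b ^ Suc n)" using assms(2) by simp
    then have "\<not> p dvd b ^ Suc n"
      using \<open>p > 1\<close> by (metis coprime_absorb_left less_irrefl nat_dvd_1_iff_1)
    then have "m \<noteq> int p"
      using cong_dvd_iff[OF cong] by (metis dvd_refl int_dvd_int_iff)
    with m cong have m_eq: "m = int (b ^ Suc n mod p)"
      by (simp add: cong_def zmod_int)
    then have "x = real (b ^ Suc n mod p) / real p"
      using mx \<open>p > 1\<close> by (simp add: field_simps)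
    moreover have "int (p * c (Suc n) + b ^ Suc n mod p) = int (b * (b ^ n mod p))"
      using m_eq unfolding m_def by simp
    ultimately show ?thesis using tail by (simp only: of_nat_eq_iff)
  qed
  show tails: "(\<lambda>j. real (c (n + Suc j)) / real b ^ Suc j) sums (real (b ^ n mod p) / real p)" for n
  proof (induction n)
    case 0
    then show ?case using sums \<open>p > 1\<close> by simp
  next
    case (Suc n)
    then show ?case using step by blast
  qed
  show "p * c (Suc n) + b ^ Suc n mod p = b * (b ^ n mod p)"
    using step[OF tails] by blast
qed

text \<open>The digit relation is summed over one period. The remainders return to their initial
  value after \<open>ord p b\<close> steps, so shifting the index leaves their sum unchanged. The
  additive form avoids truncated subtraction.\<close>

lemma digit_sum:
  fixes p b :: nat and c :: "nat \<Rightarrow> nat"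
  assumes "p > 1" "coprime p b" "b \<ge> 2" and "\<And>j. c (Suc j) \<le> b - 1"
    and "(\<lambda>j. real (c (Suc j)) / real b ^ Suc j) sums (1 / real p)"
  shows "p * (\<Sum>j = 1..ord p b. c j) + (\<Sum>j<ord p b. b ^ j mod p) = b * (\<Sum>j<ord p b. b ^ j mod p)"
proof -
  let ?l = "ord p b" and ?r = "\<lambda>j. b ^ j mod p"
  have "?r ?l = ?r 0" using ord[of b p] by (simp add: cong_def)
  then have "(\<Sum>j<?l. ?r j) = (\<Sum>j<?l. ?r (Suc j))"
    using sum.lessThan_Suc[of ?r ?l] sum.lessThan_Suc_shift[of ?r ?l] by simp
  moreover have "(\<Sum>j = 1..?l. c j) = (\<Sum>j<?l. c (Suc j))"
    by (rule sum.reindex_bij_witness[of _ Suc "\<lambda>j. j - 1"]) auto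
  moreover have "(\<Sum>j<?l. p * c (Suc j) + ?r (Suc j)) = (\<Sum>j<?l. b * ?r j)"
    using digit_tail_sums(2)[OF assms] by (intro sum.cong) auto
  ultimately show ?thesis
    by (simp only: sum.distrib flip: sum_distrib_left)
qed

section \<open>Values of characters and sums of odd powers\<close>

lemma dirichlet_group_one:
  "\<one>\<^bsub>dirichlet_group n\<^esub> a = (if coprime a (int n) then 1 else 0)"
  by (simp add: dirichlet_group_def)

text \<open>The case distinction matters for \<open>j = 0\<close>: the trivial character vanishes at
  non-coprime arguments, whereas \<open>0 ^ 0 = 1\<close>.\<close>

lemma dirichlet_group_nat_pow:
  "(\<psi> [^]\<^bsub>dirichlet_group n\<^esub> (j::nat)) a = (if coprime a (int n) then \<psi> a ^ j else 0)"
  if "\<psi> \<in> carrier (dirichlet_group n)"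
  using that
  by (induction j) (auto simp: dirichlet_group_def dirichlet_character_def nat_pow_def)

lemma dirichlet_character_power:
  assumes "dirichlet_character n \<psi>"
  shows "\<psi> (a ^ i) = \<psi> a ^ i"
proof -
  have "\<psi> 1 * \<psi> 1 = \<psi> 1" "\<psi> 1 \<noteq> 0"
    using assms unfolding dirichlet_character_def by (metis mult_1, simp)
  then have "\<psi> 1 = 1" by simp
  then show ?thesis
    using assms by (induction i) (auto simp: dirichlet_character_def)
qed

text \<open>The sum is \<open>z\<close> times a geometric sum in the square of \<open>z\<close>. As
  \<open>z ^ q = 1\<close>, this vanishes unless the square is 1, that is, unless \<open>z\<close>
  is 1 or -1.\<close>

lemma sum_odd_powers:
  fixes z :: complex
  assumes "even q" "q > 0" "z ^ q = 1"
  shows "(\<Sum>j | j \<in> {1..q - 1} \<and> odd j. z ^ j) =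
    of_nat q / 2 * (of_bool (z = 1) - of_bool (z = -1))"
proof -
  obtain h where h: "q = 2 * h" using \<open>even q\<close> by blast
  have "(\<Sum>j | j \<in> {1..q - 1} \<and> odd j. z ^ j) = (\<Sum>i<h. z ^ (2 * i + 1))"
    by (rule sum.reindex_bij_witness[of _ "\<lambda>i. 2 * i + 1" "\<lambda>j. j div 2"])
       (use h \<open>q > 0\<close> in auto)
  also have "\<dots> = z * (\<Sum>i<h. (z\<^sup>2) ^ i)"
    by (simp add: sum_distrib_left power_mult)
  also have "\<dots> = of_nat h * (of_bool (z = 1) - of_bool (z = -1))"
  proof (cases "z\<^sup>2 = 1")
    case True
    then show ?thesis by (auto simp: power2_eq_1_iff)
  next
    case False
    then have "(\<Sum>i<h. (z\<^sup>2) ^ i) = 0"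
      using assms(3) by (simp add: geometric_sum h power_mult)
    then show ?thesis using False by (auto simp: power2_eq_1_iff)
  qed
  finally show ?thesis using h by simp
qed

lemma card_odd_upto:
  assumes "even q" "q > 0"
  shows "card {j \<in> {1..q - 1}. odd j} = q div 2"
proof -
  have "bij_betw (\<lambda>i. 2 * i + 1) {..<q div 2} {j \<in> {1..q - 1}. odd j}"
    by (rule bij_betw_byWitness[of _ "\<lambda>j. j div 2"]) (use assms in auto)
  from bij_betw_same_card[OF this] show ?thesis by simp
qed

text \<open>
  With a primitive root \<open>g\<close>, both sides turn out to be the residues of the powers of \<open>g ^ q\<close>:
  \<open>b\<close> lies in the kernel because \<open>b ^ l = 1\<close>, and the kernel has at most \<open>l\<close> elements.
\<close>

lemma dirichlet_kernel_eq_powers: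
  fixes p b q :: nat
  assumes p: "prime p" and b: "\<not> p dvd b" and lq: "ord p b * q = p - 1"
    and \<chi>: "\<chi> \<in> carrier (dirichlet_group p)"
    and ord: "group.ord (dirichlet_group p) \<chi> = q"
  shows "{k \<in> {1..p - 1}. \<chi> (int k) = 1} = (\<lambda>j. b ^ j mod p) ` {..<ord p b}" (is "?K = ?R")
proof -
  interpret D: comm_group "dirichlet_group p" by (rule comm_group_dirichlet_group)
  let ?l = "ord p b"
  have char: "dirichlet_character p \<chi>" using \<chi> by (simp add: dirichlet_group_def)
  have p1: "p > 1" using p prime_gt_1_nat by blast
  obtain g where g: "residue_primroot p g" using prime_primitive_root_exists p p1 by blast
  have pow_g: "\<exists>i<p - 1. k = g ^ i mod p" if "k \<in> {1..p - 1}" for k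
  proof -
    have "(\<lambda>i. g ^ i mod p) ` {..<p - 1} = {0<..<p}"
      using residue_primroot_is_generator[OF p1 g] totient_prime[OF p] totatives_prime[OF p]
      by (simp add: bij_betw_def)
    moreover have "k \<in> {0<..<p}" using that by auto
    ultimately show ?thesis by blast
  qed
  have \<chi>_mod: "\<chi> (int (a mod p)) = \<chi> (int a)" for a
  proof -
    have "[int (a mod p) = int a] (mod int p)" by (simp add: cong_int_iff)
    then show ?thesis using char unfolding dirichlet_character_def by blast
  qed
  have \<chi>_pow: "\<chi> (int (a ^ i mod p)) = \<chi> (int a) ^ i" for a i
    using dirichlet_character_power[OF char] by (simp only: \<chi>_mod) simp
  \<comment> \<open>Every unit modulo \<open>p\<close> is a power of \<open>g\<close>, so a power of
    \<open>\<chi>\<close> is trivial as soon as its value at \<open>g\<close> is 1. Hence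
    \<open>\<chi> (int g)\<close> has the same order \<open>q\<close> as
    \<open>\<chi>\<close>.\<close>
  have \<chi>_g: "\<chi> (int g) ^ i = 1 \<longleftrightarrow> q dvd i" for i
  proof
    assume gi: "\<chi> (int g) ^ i = 1"
    have "(\<chi> [^]\<^bsub>dirichlet_group p\<^esub> i) a = \<one>\<^bsub>dirichlet_group p\<^esub> a" for a
    proof (cases "coprime a (int p)")
      case True
      define k where "k = nat (a mod int p)"
      have k: "int k = a mod int p" using p1 by (simp add: k_def)
      have "a mod int p \<noteq> 0"
        using True p1 coprime_common_divisor[of a "int p" "int p"] by (auto simp: dvd_eq_mod_eq_0)
      moreover have "a mod int p < int p" "a mod int p \<ge> 0" using p1 by auto
      ultimately have "k \<in> {1..p - 1}" using k by auto
      then obtain m where "k = g ^ m mod p" using pow_g by blast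
      then have "\<chi> (int k) = \<chi> (int g) ^ m" using \<chi>_pow by simp
      moreover have "\<chi> (int k) = \<chi> a"
      proof -
        have "[int k = a] (mod int p)" by (simp add: k cong_def)
        then show ?thesis using char unfolding dirichlet_character_def by blast
      qed
      ultimately have "\<chi> a ^ i = (\<chi> (int g) ^ i) ^ m"
        by (simp add: mult.commute flip: power_mult)
      then have "\<chi> a ^ i = 1" using gi by simp
      then show ?thesis using True by (simp add: dirichlet_group_nat_pow[OF \<chi>] dirichlet_group_one)
    next
      case False
      then show ?thesis by (simp add: dirichlet_group_nat_pow[OF \<chi>] dirichlet_group_one)
    qed
    then have "\<chi> [^]\<^bsub>dirichlet_group p\<^esub> i = \<one>\<^bsub>dirichlet_group p\<^esub>" by blast
    then show "q dvd i" using D.pow_eq_id[OF \<chi>] ord by simp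
  next
    assume "q dvd i"
    then have "\<chi> [^]\<^bsub>dirichlet_group p\<^esub> i = \<one>\<^bsub>dirichlet_group p\<^esub>"
      using D.pow_eq_id[OF \<chi>] ord by simp
    from fun_cong[OF this, of "int g"] show "\<chi> (int g) ^ i = 1"
      using g by (auto simp: dirichlet_group_nat_pow[OF \<chi>] residue_primroot_def
          coprime_commute dirichlet_group_one)
  qed
  have cop: "coprime p b" using p b prime_imp_coprime by blast
  have "b mod p \<in> {1..p - 1}"
    using b p1 by (auto simp: Suc_le_eq dvd_eq_mod_eq_0 less_Suc_eq_le[symmetric])
  then obtain i where i: "b mod p = g ^ i mod p" using pow_g by blast
  \<comment> \<open>From \<open>b ^ l = 1\<close> it follows that \<open>p - 1 = l * q\<close>
    divides \<open>i * l\<close>; cancelling \<open>l\<close> shows that the index \<open>i\<close>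
    of \<open>b\<close> is a multiple of \<open>q\<close>.\<close>
  have "[(g ^ i) ^ ?l = 1] (mod p)"
    using cong_trans[OF cong_pow Pocklington.ord, of "g ^ i" b p] i by (simp add: cong_def)
  then have "ord p g dvd i * ?l" by (simp only: ord_divides flip: power_mult)
  then have "p - 1 dvd i * ?l"
    using g totient_prime[OF p] by (simp add: residue_primroot_def)
  then have "?l * q dvd ?l * i" by (simp only: lq mult.commute[of ?l i])
  moreover have "?l > 0" using cop by simp
  ultimately have "q dvd i" by simp
  then have "\<chi> (int g) ^ i = 1" using \<chi>_g by blast
  then have "\<chi> (int (b mod p)) = 1" unfolding i \<chi>_pow .
  then have \<chi>_b: "\<chi> (int b) = 1" by (simp only: \<chi>_mod)
  have "?R \<subseteq> ?K"
  proof
    fix k assume "k \<in> ?R"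
    then obtain j where j: "k = b ^ j mod p" by blast
    have "\<not> p dvd b ^ j" using p b prime_dvd_power by blast
    then have "k \<in> {1..p - 1}"
      using j p1 by (auto simp: Suc_le_eq dvd_eq_mod_eq_0 less_Suc_eq_le[symmetric])
    then show "k \<in> ?K" using j \<chi>_pow \<chi>_b by simp
  qed
  moreover have "card ?K \<le> card ?R"
  proof -
    \<comment> \<open>A kernel element is \<open>g ^ i\<close> with \<open>q dvd i\<close> and
      \<open>i < q * l\<close>, which leaves \<open>l\<close> exponents.\<close>
    have "?K \<subseteq> (\<lambda>m. g ^ (q * m) mod p) ` {..<?l}"
    proof
      fix k assume k: "k \<in> ?K"
      then obtain i where i: "i < p - 1" "k = g ^ i mod p" using pow_g by blast
      then have "q dvd i" using k \<chi>_pow \<chi>_g by auto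
      then obtain m where "i = q * m" by blast
      moreover from this have "q * m < q * ?l" using i lq by (simp only: mult.commute[of q ?l])
      then have "m < ?l" by simp
      ultimately show "k \<in> (\<lambda>m. g ^ (q * m) mod p) ` {..<?l}" using i by blast
    qed
    then have "card ?K \<le> card ((\<lambda>m. g ^ (q * m) mod p) ` {..<?l})" by (intro card_mono) auto
    also have "\<dots> \<le> ?l" using card_image_le[of "{..<?l}"] by simp
    also have "?l = card ?R" using inj_power_mod[OF cop] by (simp add: card_image)
    finally show ?thesis .
  qed
  ultimately show ?thesis by (intro card_seteq[symmetric]) auto
qed

section \<open>The odd characters generated by one character, and the digit sum\<close>

theorem theorem1:
  fixes p b l q S :: nat and c :: "nat \<Rightarrow> nat"
    and \<chi> :: "int \<Rightarrow> complex" and odds :: "(int \<Rightarrow> complex) set" and E :: complex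
  assumes "prime p" and "p \<ge> 3" and "b \<ge> 2" and "\<not> p dvd b"
    and "l = ord p b" and "odd l"
    and "q > 0" and "real l = (real p - 1) / real q"
    and "\<chi> \<in> carrier (dirichlet_group p)"
    and "group.ord (dirichlet_group p) \<chi> = q"
    and "\<forall>j\<ge>1. c j \<in> {0..b - 1}"
    and "(\<lambda>j. real (c (Suc j)) / real b ^ Suc j) sums (1 / real p)"
    and "S = (\<Sum>j = 1..l. c j)"
    and "odds = {\<psi> \<in> generate (dirichlet_group p) {\<chi>}. odd_character \<psi>}"
    and "E = (\<Sum>\<psi>\<in>odds. gen_bernoulli p \<psi>) / of_nat (card odds)"
  shows "E = 2 / of_nat q *
           (\<Sum>j | j \<in> {1..q - 1} \<and> odd j. gen_bernoulli p (\<chi> [^]\<^bsub>dirichlet_group p\<^esub> j)) \<and>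
         of_nat S = (of_nat b - 1) / 2 * of_nat l + (of_nat b - 1) / 2 * E"
proof -
  interpret D: comm_group "dirichlet_group p" by (rule comm_group_dirichlet_group)
  note p = \<open>prime p\<close> and \<chi> = \<open>\<chi> \<in> carrier (dirichlet_group p)\<close>
  have char: "dirichlet_character p \<chi>" using \<chi> by (simp add: dirichlet_group_def)
  have p1: "p > 1" using \<open>p \<ge> 3\<close> by simp
  have cop: "coprime p b" using p \<open>\<not> p dvd b\<close> prime_imp_coprime by blast
  have "real (l * q) = real (p - 1)"
    using \<open>real l = _\<close> \<open>q > 0\<close> p1 by (simp add: field_simps of_nat_diff)
  then have lq: "l * q = p - 1" by (simp only: of_nat_eq_iff)
  have "even (p - 1)" using p \<open>p \<ge> 3\<close> prime_odd_nat[of p] by simp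
  then have q: "even q" using \<open>odd l\<close> unfolding lq[symmetric] by simp
  let ?odd = "{j. j \<in> {1..q - 1} \<and> odd j}"
  let ?pow = "\<lambda>j::nat. \<chi> [^]\<^bsub>dirichlet_group p\<^esub> j"
  define K where "K = {k \<in> {1..p - 1}. \<chi> (int k) = 1}"
  have K: "K = (\<lambda>j. b ^ j mod p) ` {..<l}"
    unfolding K_def \<open>l = _\<close>
    by (rule dirichlet_kernel_eq_powers) (use assms lq in auto)
  have inj: "inj_on (\<lambda>j. b ^ j mod p) {..<l}"
    using inj_power_mod[OF cop] \<open>l = _\<close> by simp
  have \<chi>_neg: "\<chi> (- 1) = - 1"
  proof -
    have "\<chi> ((- 1) ^ 2) = \<chi> (- 1) ^ 2" "\<chi> ((- 1) ^ 0) = \<chi> (- 1) ^ 0"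
      using dirichlet_character_power[OF char] by blast+
    then have "(\<chi> (- 1))\<^sup>2 = 1" by simp
    moreover have "\<chi> (- 1) \<noteq> 1"
    proof
      assume *: "\<chi> (- 1) = 1"
      have "\<chi> (int (p - 1)) = \<chi> (- 1)"
        using char p1 unfolding dirichlet_character_def
        by (simp add: cong_iff_dvd_diff of_nat_diff)
      then have "p - 1 \<in> K" using * p1 by (simp add: K_def)
      then obtain j where j: "p - 1 = b ^ j mod p" using K by blast
      then have "[int (b ^ j) = int (p - 1)] (mod int p)"
        by (simp add: cong_def zmod_int)
      also have "[int (p - 1) = - 1] (mod int p)"
        using p1 by (simp add: cong_iff_dvd_diff of_nat_diff)
      \<comment> \<open>Raising to the power \<open>l\<close> gives 1 on the left, because
        \<open>b\<close> has order \<open>l\<close>, and -1 on the right, because \<open>l\<close>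
        is odd.\<close>
      finally have "[int (b ^ j) ^ l = (- 1) ^ l] (mod int p)" by (rule cong_pow)
      then have "[int ((b ^ l) ^ j) = - 1] (mod int p)"
        using \<open>odd l\<close> by (simp flip: power_mult add: mult.commute)
      moreover have "[int ((b ^ l) ^ j) = int (1 ^ j)] (mod int p)"
        unfolding cong_int_iff using Pocklington.ord[of b p] \<open>l = _\<close> by (intro cong_pow) simp
      ultimately have "[1 = - 1] (mod int p)"
        by (metis cong_sym cong_trans of_nat_1 power_one)
      then have "int p dvd 2" by (simp add: cong_iff_dvd_diff)
      then show False using \<open>p \<ge> 3\<close> by (auto dest: zdvd_imp_le)
    qed
    ultimately show ?thesis by (simp add: power2_eq_1_iff)
  qed
  have odd_pow: "odd_character (?pow j) \<longleftrightarrow> odd j" for j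
    by (cases "even j") (auto simp: odd_character_def dirichlet_group_nat_pow[OF \<chi>] \<chi>_neg)
  have inj_pow: "inj_on ?pow {0..q - 1}"
    using D.ord_inj[OF \<chi>] assms by simp
  \<comment> \<open>As \<open>\<chi>\<close> has finite order \<open>q\<close>, exponents from 0 to
    \<open>q - 1\<close> suffice; by \<open>inj_pow\<close> they give distinct characters, so sums
    over \<open>odds\<close> become sums over odd exponents.\<close>
  have "generate (dirichlet_group p) {\<chi>} = ?pow ` {0..q - 1}"
    using D.generate_pow_nat[OF \<chi>] D.ord_elems_inf_carrier[OF \<chi>] assms by auto
  then have "odds = {\<psi> \<in> ?pow ` {0..q - 1}. odd_character \<psi>}" using assms by simp
  also have "\<dots> = ?pow ` ?odd"
  proof -
    have "{j \<in> {0..q - 1}. odd j} = ?odd" using odd_pos by fastforce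
    then show ?thesis using odd_pow by blast
  qed
  finally have odds: "odds = ?pow ` ?odd" .
  have inj_odd: "inj_on ?pow ?odd" by (rule inj_on_subset[OF inj_pow]) auto
  have "card odds = q div 2"
    using odds card_image[OF inj_odd] card_odd_upto[OF q \<open>q > 0\<close>] by simp
  then have card: "of_nat (card odds) = (of_nat q / 2 :: complex)"
    using q by (simp add: field_char_0_class.of_nat_div)
  have E1: "E = 2 / of_nat q * (\<Sum>j\<in>?odd. gen_bernoulli p (?pow j))"
  proof -
    have "(\<Sum>\<psi>\<in>odds. gen_bernoulli p \<psi>) = (\<Sum>j\<in>?odd. gen_bernoulli p (?pow j))"
      unfolding odds sum.reindex[OF inj_odd] o_def ..
    then show ?thesis using assms(15) by (simp only: card) simp
  qed

  \<comment> \<open>Bernoulli numbers summed over the odd characters\<close>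
  have copk: "coprime (int k) (int p)" if "k \<in> {1..p - 1}" for k
  proof -
    have "\<not> p dvd k" using that p1 by (auto dest: dvd_imp_le)
    then have "coprime p k" using p prime_imp_coprime by blast
    then show ?thesis by (simp add: coprime_commute)
  qed
  have \<chi>_q: "\<chi> (int k) ^ q = 1" if "k \<in> {1..p - 1}" for k
  proof -
    have "?pow q = \<one>\<^bsub>dirichlet_group p\<^esub>" using D.pow_ord_eq_1[OF \<chi>] assms by simp
    from fun_cong[OF this, of "int k"] show ?thesis
      using copk[OF that] unfolding dirichlet_group_nat_pow[OF \<chi>] dirichlet_group_one by simp
  qed
  \<comment> \<open>\<open>sum_odd_powers\<close> is applied to \<open>z = \<chi> (int k)\<close>.
    The residue \<open>p - k\<close> represents \<open>-k\<close>, so it lies in \<open>K\<close>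
    exactly when \<open>z = -1\<close>.\<close>
  have sum_pow: "(\<Sum>j\<in>?odd. ?pow j (int k)) =
      of_nat q / 2 * (of_bool (k \<in> K) - of_bool (p - k \<in> K))" if k: "k \<in> {1..p - 1}" for k
  proof -
    have "\<chi> (int (p - k)) = \<chi> (- 1 * int k)"
      using char k unfolding dirichlet_character_def
      by (auto simp: cong_iff_dvd_diff of_nat_diff)
    also have "\<dots> = - \<chi> (int k)"
      using char \<chi>_neg unfolding dirichlet_character_def by (metis mult_minus1)
    finally have "p - k \<in> K \<longleftrightarrow> \<chi> (int k) = - 1"
      using k by (auto simp: K_def minus_equation_iff)
    moreover have "k \<in> K \<longleftrightarrow> \<chi> (int k) = 1" using k by (simp add: K_def)
    ultimately show ?thesis
      using sum_odd_powers[OF q \<open>q > 0\<close> \<chi>_q[OF k]] copk[OF k]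
      by (simp add: dirichlet_group_nat_pow[OF \<chi>])
  qed
  define T where "T = (\<Sum>k\<in>K. of_nat k :: complex)"
  have K_sub: "K \<subseteq> {1..p - 1}" by (auto simp: K_def)
  have card_K: "card K = l" using K card_image[OF inj] by simp
  have sum1: "(\<Sum>k = 1..p - 1. of_nat k * of_bool (k \<in> K)) = T"
    unfolding T_def by (rule sum.mono_neutral_cong_right) (use K_sub in auto)
  \<comment> \<open>The reflection of \<open>k\<close> to \<open>p - k\<close> turns the sum over
    the negatives of the kernel into a sum over \<open>K\<close>.\<close>
  have "(\<Sum>k = 1..p - 1. of_nat k * of_bool (p - k \<in> K)) =
      (\<Sum>k = 1..p - 1. of_nat (p - k) * of_bool (k \<in> K) :: complex)"
    by (rule sum.reindex_bij_witness[of _ "\<lambda>k. p - k" "\<lambda>k. p - k"]) auto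
  also have "\<dots> = (\<Sum>k\<in>K. of_nat (p - k))"
    by (rule sum.mono_neutral_cong_right) (use K_sub in auto)
  also have "\<dots> = (\<Sum>k\<in>K. of_nat p - of_nat k)"
    by (intro sum.cong refl of_nat_diff) (use K_sub in fastforce)
  also have "\<dots> = of_nat p * of_nat l - T"
    by (simp add: sum_subtractf T_def card_K mult.commute)
  finally have sum2: "(\<Sum>k = 1..p - 1. of_nat k * of_bool (p - k \<in> K)) = of_nat p * of_nat l - T" .
  have "(\<Sum>j\<in>?odd. gen_bernoulli p (?pow j)) =
      1 / of_nat p * (\<Sum>j\<in>?odd. \<Sum>k = 1..p - 1. of_nat k * ?pow j (int k))"
    unfolding gen_bernoulli_def by (rule sum_distrib_left[symmetric])
  also have "(\<Sum>j\<in>?odd. \<Sum>k = 1..p - 1. of_nat k * ?pow j (int k)) =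
      (\<Sum>k = 1..p - 1. of_nat k * (\<Sum>j\<in>?odd. ?pow j (int k)))"
    unfolding sum_distrib_left by (rule sum.swap)
  also have "(\<Sum>k = 1..p - 1. of_nat k * (\<Sum>j\<in>?odd. ?pow j (int k))) =
      of_nat q / 2 * ((\<Sum>k = 1..p - 1. of_nat k * of_bool (k \<in> K)) -
                      (\<Sum>k = 1..p - 1. of_nat k * of_bool (p - k \<in> K)))"
  proof -
    have "of_nat k * (\<Sum>j\<in>?odd. ?pow j (int k)) = of_nat q / 2 *
        (of_nat k * of_bool (k \<in> K) - of_nat k * of_bool (p - k \<in> K))"
      if "k \<in> {1..p - 1}" for k
      unfolding sum_pow[OF that] by (simp add: algebra_simps)
    then show ?thesis
      unfolding sum_subtractf[symmetric] by (subst sum_distrib_left) (rule sum.cong, simp_all)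
  qed
  \<comment> \<open>The factors \<open>2 / q\<close> and \<open>q / 2\<close> cancel, and the
    difference of the two sums is \<open>2 * T - p * l\<close>.\<close>
  finally have E2: "E = 2 / of_nat p * T - of_nat l"
    using \<open>q > 0\<close> p1 unfolding E1 sum1 sum2 by (simp add: field_simps)

  have "p * S + \<Sum>K = b * \<Sum>K"
  proof -
    have "\<Sum>K = (\<Sum>j<l. b ^ j mod p)" unfolding K sum.reindex[OF inj] by simp
    moreover have "c (Suc j) \<le> b - 1" for j using assms(11) by simp
    ultimately show ?thesis
      using digit_sum[OF p1 cop \<open>b \<ge> 2\<close>, of c] assms(5,12,13) by (simp only:)
  qed
  then have "of_nat (p * S + \<Sum>K) = (of_nat (b * \<Sum>K) :: complex)" by (rule arg_cong)
  then have "of_nat p * of_nat S = (of_nat b - 1) * T"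
    by (simp add: T_def algebra_simps)
  then have "of_nat S = (of_nat b - 1) * T / of_nat p"
    using p1 by (simp add: field_simps)
  \<comment> \<open>By \<open>E2\<close>, \<open>T / p\<close> equals
    \<open>(l + E) / 2\<close>.\<close>
  also have "\<dots> = (of_nat b - 1) / 2 * of_nat l + (of_nat b - 1) / 2 * E"
    using p1 unfolding E2 by (simp add: field_simps)
  finally have "of_nat S = (of_nat b - 1) / 2 * of_nat l + (of_nat b - 1) / 2 * E" .
  with E1 show ?thesis by blast
qed

end
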